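(* Let $n,m,L,T\in\mathbb{N}$ and consider the noisy LTV system $$x(k+1)=A(k)x(k)+B(k)u(k)+d(k),\qquad \zeta(k)=x(k)+v(k),$$ with $A(k)\in\mathbb{R}^{n\times n}$, $B(k)\in\mathbb{R}^{n\times m}$. Let $Z(k)\in\mathbb{R}^{n\times L}$, $k=0,\dots,T$, and $U(k)\in\mathbb{R}^{m\times L}$, $k=0,\dots,T-1$, be the data matrices formed from an ensemble of $L$ input-output data sequences of this system, with associated noise matrices $V(k)$, $D(k)$ (see context), and suppose that $$\mathrm{rank}\begin{bmatrix}Z(k)\\ U(k)\end{bmatrix}=n+m,\qquad k=0,\dots,T-1.$$ Suppose that $W(k)=A(k)V(k)-V(k+1)-D(k)\in\mathbb{R}^{n\times L}$ satisfies $$\begin{bmatrix}I_n\\ W(k)^\top\end{bmatrix}^\top\begin{bmatrix}Q_r(k)&S_r(k)\\ S_r(k)^\top&R_r(k)\end{bmatrix}\begin{bmatrix}I_n\\ W(k)^\top\end{bmatrix}\succeq0,\qquad k=0,\dots,T-1,$$ where $Q_r(k)\in\mathbb{R}^{n\times n}$ is symmetric, $S_r(k)\in\mathbb{R}^{n\times L}$, and $R_r(k)\in\mathbb{R}^{L\times L}$ is symmetric with $R_r(k)\prec0$. Let $\eta\ge1$ and $\rho>\eta$ be finite constants, and let $Y(k)\in\mathbb{R}^{L\times n}$, $k=0,\dots,T-1$, and $P(k)=P(k)^\top\in\mathbb{R}^{n\times n}$, $k=0,\dots,T$, be any sequences of matrices satisfying $$\begin{bmatrix}P(k+1)-I_n-Q_r(k)&-S_r(k)&Z(k+1)Y(k)\\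 -S_r(k)^\top&-R_r(k)&Y(k)\\ Y(k)^\top Z(k+1)^\top&Y(k)^\top&P(k)\end{bmatrix}\succ0,\qquad Z(k)Y(k)=P(k),$$ for $k=0,\dots,T-1$, and $\eta I_n\preceq P(k)\preceq\rho I_n$ for $k=0,\dots,T$. Then, with $$K(k)=U(k)Y(k)P(k)^{-1},\qquad k=0,\dots,T-1,$$ there exist, for each $k=0,\dots,T$, class $\mathcal K$-functions $\gamma_1(\cdot,k)$, $\gamma_2(\cdot,k)$ (not depending on $x(0)$, $v$, $d$) such that the trajectories of the closed-loop system $$x(k+1)=\big(A(k)+B(k)K(k)\big)x(k)+B(k)K(k)v(k)+d(k)$$ satisfy $$\|x(k)\|\le\sqrt{\frac\rho\eta}\left(1-\frac1\rho\right)^{k/2}\|x(0)\|+\gamma_1\big(|v|_{k-1},k\big)+\gamma_2\big(|d|_{k-1},k\big),\qquad k=0,\dots,T.$$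
   Context: $\|\cdot\|$ is the Euclidean norm; $\succ,\succeq,\prec,\preceq$ refer to the (semi)definite ordering of symmetric matrices. For a signal $z$, $|z|_k=\sup\{\|z(j)\|:0\le j\le k\}$, with the convention $|z|_{-1}=0$. A function $\gamma:\mathbb{R}_{\ge0}\to\mathbb{R}_{\ge0}$ is of class $\mathcal K$ if it is continuous, strictly increasing and $\gamma(0)=0$. The closed-loop system arises from the feedback $u(k)=K(k)\zeta(k)$. The closed-loop noise signals $v,d$ are not tied to the noise samples occurring in the data. Data: for each experiment $j=1,\dots,L$, the input $u_{d,j}(k)$ ($k=0,\dots,T-1$) and the noisy state measurement $\zeta_{d,j}(k)=x_{d,j}(k)+v_{d,j}(k)$ ($k=0,\dots,T$) are recorded, where $x_{d,j}(k+1)=A(k)x_{d,j}(k)+B(k)u_{d,j}(k)+d_{d,j}(k)$; all experiments share the same $A(k),B(k)$ (same time-varying behaviour). The states $x_{d,j}$, measurement noise $v_{d,j}$ and process noise $d_{d,j}$ are not measured. The matrices are $Z(k)=[\zeta_{d,1}(k),\dots,\zeta_{d,L}(k)]$, $U(k)=[u_{d,1}(k),\dots,u_{d,L}(k)]$, $X(k)=[x_{d,1}(k),\dots,x_{d,L}(k)]$, $V(k)=[v_{d,1}(k),\dots,v_{d,L}(k)]$, $D(k)=[d_{d,1}(k),\dots,d_{d,L}(k)]$, so that $X(k+1)=A(k)X(k)+B(k)U(k)+D(k)$ and $Z(k)=X(k)+V(k)$. *)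

theory Defs
  imports "HOL-Analysis.Analysis"
begin

text \<open>An \<open>r \<times> c\<close> real matrix has type \<open>real ^ 'c ^ 'r\<close>; block matrices are
  indexed by sum types.\<close>

definition hcat :: "real ^ 'c ^ 'r \<Rightarrow> real ^ 'd ^ 'r \<Rightarrow> real ^ ('c + 'd) ^ 'r" where
  "hcat M N = (\<chi> i j. case j of Inl a \<Rightarrow> M $ i $ a | Inr b \<Rightarrow> N $ i $ b)"

definition vcat :: "real ^ 'c ^ 'r \<Rightarrow> real ^ 'c ^ 's \<Rightarrow> real ^ 'c ^ ('r + 's)" where
  "vcat M N = (\<chi> i. case i of Inl a \<Rightarrow> M $ a | Inr b \<Rightarrow> N $ b)"

definition block2 ::
  "real ^ 'c ^ 'r \<Rightarrow> real ^ 'd ^ 'r \<Rightarrow>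
   real ^ 'c ^ 's \<Rightarrow> real ^ 'd ^ 's \<Rightarrow> real ^ ('c + 'd) ^ ('r + 's)" where
  "block2 M11 M12 M21 M22 = vcat (hcat M11 M12) (hcat M21 M22)"

definition block3 ::
  "real ^ 'c ^ 'r \<Rightarrow> real ^ 'd ^ 'r \<Rightarrow> real ^ 'e ^ 'r \<Rightarrow>
   real ^ 'c ^ 's \<Rightarrow> real ^ 'd ^ 's \<Rightarrow> real ^ 'e ^ 's \<Rightarrow>
   real ^ 'c ^ 't \<Rightarrow> real ^ 'd ^ 't \<Rightarrow> real ^ 'e ^ 't \<Rightarrow>
   real ^ ('c + ('d + 'e)) ^ ('r + ('s + 't))" where
  "block3 M11 M12 M13 M21 M22 M23 M31 M32 M33 =
     vcat (hcat M11 (hcat M12 M13))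
       (vcat (hcat M21 (hcat M22 M23))
             (hcat M31 (hcat M32 M33)))"

definition symmetric_mat :: "real ^ 'n ^ 'n \<Rightarrow> bool" where
  "symmetric_mat M \<longleftrightarrow> transpose M = M"

definition mat_le :: "real ^ 'n ^ 'n \<Rightarrow> real ^ 'n ^ 'n \<Rightarrow> bool" (infix "\<preceq>" 50) where
  "M \<preceq> N \<longleftrightarrow> symmetric_mat M \<and> symmetric_mat N \<and> (\<forall>x. 0 \<le> x \<bullet> ((N - M) *v x))"

definition mat_less :: "real ^ 'n ^ 'n \<Rightarrow> real ^ 'n ^ 'n \<Rightarrow> bool" (infix "\<prec>" 50) where
  "M \<prec> N \<longleftrightarrow> symmetric_mat M \<and> symmetric_mat N \<and> (\<forall>x. x \<noteq> 0 \<longrightarrow> 0 < x \<bullet> ((N - M) *v x))"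

text \<open>The integer index accommodates the empty window \<open>k = -1\<close>.\<close>

definition sup_norm :: "(nat \<Rightarrow> 'a :: real_normed_vector) \<Rightarrow> int \<Rightarrow> real" where
  "sup_norm z k = (if k < 0 then 0 else (SUP j\<in>{j. int j \<le> k}. norm (z j)))"

text \<open>Functions on the nonnegative reals are represented by functions on the reals whose
  values at negative arguments are irrelevant.\<close>

definition class_K :: "(real \<Rightarrow> real) \<Rightarrow> bool" where
  "class_K \<gamma> \<longleftrightarrow> \<gamma> ` {0..} \<subseteq> {0..} \<and> continuous_on {0..} \<gamma> \<and> strict_mono_on {0..} \<gamma> \<and> \<gamma> 0 = 0"

text \<open>The \<open>j\<close>-th column is the time-\<open>k\<close> sample of the \<open>j\<close>-th experiment.\<close>

definition data_matrix :: "('l \<Rightarrow> nat \<Rightarrow> real ^ 'n) \<Rightarrow> nat \<Rightarrow> real ^ 'l ^ 'n" where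
  "data_matrix z k = (\<chi> i j. z j k $ i)"

end

theory Submission
  imports Defs
begin

text \<open>Write \<open>F k = A k + B k ** K k\<close> for the closed-loop matrix. The plant is unknown, but the
  data equation \<open>A Z + B U = Z\<^sup>+ + W\<close> multiplied by \<open>Y\<close> gives \<open>F P = (Z\<^sup>+ + W) Y\<close>, where \<open>Z\<^sup>+\<close> and
  \<open>P\<^sup>+\<close> are the next samples. So the only unknown left in \<open>F P\<close> is \<open>W\<close>, which the noise bound
  controls. Evaluating the matrix inequality at the vectors \<open>(a, W\<^sup>T a, c)\<close> and adding the noise
  bound cancels \<open>Q\<^sub>r\<close>, \<open>S\<^sub>r\<close> and \<open>R\<^sub>r\<close> (an S-procedure with multiplier one); minimizing over \<open>c\<close>,
  which is done by \<open>c = - F\<^sup>T a\<close>, leaves the Lyapunov inequality \<open>F P F\<^sup>T + I \<preceq> P\<^sup>+\<close>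
  (\<open>lyapunov_step\<close>).

  Since \<open>P\<^sup>+ \<preceq> \<rho> I\<close>, it implies \<open>F P F\<^sup>T \<preceq> (1 - 1/\<rho>) P\<^sup>+\<close>. This is an inequality for the dual
  system, driven by the transposed matrices. It iterates to
  \<open>\<Phi> P(0) \<Phi>\<^sup>T \<preceq> (1 - 1/\<rho>)\<^sup>k P(k)\<close> for the transition matrix \<open>\<Phi>\<close> from time \<open>0\<close> to \<open>k\<close>, and as a
  matrix and its transpose have the same norm, \<open>\<eta> I \<preceq> P \<preceq> \<rho> I\<close> turns it into the stated decay of
  \<open>\<Phi> x(0)\<close> (\<open>transition_norm_bound\<close>).

  The remainder \<open>x(k) - \<Phi> x(0)\<close> is the response to the noise from zero initial state. Over a finite
  number of steps it is bounded by a constant times the noise, whatever the stability of the system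
  (\<open>forced_response_gain\<close>), so linear class \<open>\<K>\<close> functions suffice.\<close>

section \<open>Quadratic forms of block matrices\<close>

definition vjoin :: "real ^ 'r \<Rightarrow> real ^ 's \<Rightarrow> real ^ ('r + 's)" where
  "vjoin a b = (\<chi> i. case i of Inl r \<Rightarrow> a $ r | Inr s \<Rightarrow> b $ s)"

lemma sum_UNIV_Plus:
  fixes f :: "'r::finite + 's::finite \<Rightarrow> 'b::comm_monoid_add"
  shows "sum f UNIV = (\<Sum>r\<in>UNIV. f (Inl r)) + (\<Sum>s\<in>UNIV. f (Inr s))"
  by (simp add: sum.Plus flip: UNIV_Plus_UNIV)

lemma inner_vjoin: "vjoin a b \<bullet> vjoin c d = a \<bullet> c + b \<bullet> d"
  by (simp add: inner_vec_def vjoin_def sum_UNIV_Plus)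

lemma vcat_mult: "vcat M N *v x = vjoin (M *v x) (N *v x)"
  by (auto simp: vec_eq_iff vcat_def vjoin_def matrix_vector_mult_def split: sum.split)

lemma hcat_mult: "hcat M N *v vjoin a b = M *v a + N *v b"
  by (auto simp: vec_eq_iff hcat_def vjoin_def matrix_vector_mult_def sum_UNIV_Plus)

lemma inner_transpose_mult:
  fixes M :: "real ^ 'c ^ 'r"
  shows "x \<bullet> (transpose M *v y) = (M *v x) \<bullet> y"
  by (metis dot_lmul_matrix inner_commute transpose_matrix_vector)

lemma uminus_matrix_vector_mult:
  fixes M :: "real ^ 'c ^ 'r"
  shows "(- M) *v x = - (M *v x)"
  by (simp add: vec_eq_iff matrix_vector_mult_def sum_negf)

lemma scaleR_mat_1_mult: "(c *\<^sub>R mat 1 :: real ^ 'n ^ 'n) *v x = c *\<^sub>R x"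
  by (simp flip: scaleR_matrix_vector_assoc)

lemma mat_less_0_form_nonneg: "0 \<prec> M \<Longrightarrow> 0 \<le> x \<bullet> (M *v x)"
  by (cases "x = 0") (auto simp: mat_less_def less_imp_le)

section \<open>From data to a Lyapunov inequality\<close>

lemma noise_form_nonneg:
  fixes Q :: "real ^ 'n ^ 'n" and S W :: "real ^ 'l ^ 'n" and R :: "real ^ 'l ^ 'l"
  assumes "0 \<preceq> transpose (vcat (mat 1) (transpose W)) ** block2 Q S (transpose S) R
                ** vcat (mat 1) (transpose W)"
  shows "0 \<le> a \<bullet> (Q *v a) + 2 * (a \<bullet> (S *v (transpose W *v a)))
              + (transpose W *v a) \<bullet> (R *v (transpose W *v a))"
proof -
  have "0 \<le> a \<bullet> ((transpose (vcat (mat 1) (transpose W)) ** block2 Q S (transpose S) R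
                ** vcat (mat 1) (transpose W)) *v a)"
    using assms by (simp add: mat_le_def)
  then have "0 \<le> vjoin a (transpose W *v a) \<bullet>
      (block2 Q S (transpose S) R *v vjoin a (transpose W *v a))"
    by (simp add: inner_transpose_mult vcat_mult del: transpose_matrix_vector
        flip: matrix_vector_mul_assoc)
  moreover have "w \<bullet> (transpose S *v a) = a \<bullet> (S *v w)" for w
    by (simp only: inner_transpose_mult inner_commute)
  ultimately show ?thesis
    by (simp add: block2_def vcat_mult hcat_mult inner_vjoin inner_add_right
        del: transpose_matrix_vector)
qed

text \<open>At \<open>(a, W\<^sup>T a, c)\<close> the matrix inequality contains the negative of the noise form, so their sum is
  free of \<open>Q\<close>, \<open>S\<close>, \<open>R\<close>, and \<open>FP\<close> merges the two cross terms into \<open>2 a \<bullet> (F P c)\<close>.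
  The choice \<open>c = - F\<^sup>T a\<close>, which takes the Schur complement of \<open>P\<close>, makes that term minus
  twice \<open>c \<bullet> (P c)\<close>.\<close>

lemma lyapunov_step:
  fixes P Pn Q F :: "real ^ 'n ^ 'n" and S W Zn :: "real ^ 'l ^ 'n" and Y :: "real ^ 'n ^ 'l"
  assumes noise: "0 \<preceq> transpose (vcat (mat 1) (transpose W)) ** block2 Q S (transpose S) R
                ** vcat (mat 1) (transpose W)"
    and LMI: "0 \<prec> block3 (Pn - mat 1 - Q) (- S) (Zn ** Y)
                    (- transpose S) (- R) Y
                    (transpose Y ** transpose Zn) (transpose Y) P"
    and FP: "F ** P = (Zn + W) ** Y"
  shows "(transpose F *v a) \<bullet> (P *v (transpose F *v a)) + a \<bullet> a \<le> a \<bullet> (Pn *v a)"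
proof -
  let ?w = "transpose W *v a"
  define c where "c = - (transpose F *v a)"
  have form: "0 \<le> a \<bullet> (Pn *v a) - a \<bullet> a - a \<bullet> (Q *v a) - 2 * (a \<bullet> (S *v w))
       - w \<bullet> (R *v w) + 2 * (a \<bullet> (Zn *v (Y *v c))) + 2 * (w \<bullet> (Y *v c)) + c \<bullet> (P *v c)" for w
  proof -
    have tr: "w \<bullet> (transpose S *v a) = a \<bullet> (S *v w)"
      "c \<bullet> (transpose Y *v (transpose Zn *v a)) = a \<bullet> (Zn *v (Y *v c))"
      "c \<bullet> (transpose Y *v w) = w \<bullet> (Y *v c)"
      by (simp_all only: inner_transpose_mult inner_commute)
    have "0 \<le> vjoin a (vjoin w c) \<bullet> (block3 (Pn - mat 1 - Q) (- S) (Zn ** Y)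
                    (- transpose S) (- R) Y
                    (transpose Y ** transpose Zn) (transpose Y) P *v vjoin a (vjoin w c))"
      by (rule mat_less_0_form_nonneg[OF LMI])
    then show ?thesis
      by (simp add: block3_def vcat_mult hcat_mult inner_vjoin inner_add_right inner_diff_right
          uminus_matrix_vector_mult matrix_vector_mult_diff_rdistrib tr
          del: transpose_matrix_vector flip: matrix_vector_mul_assoc)
  qed
  have "?w \<bullet> (Y *v c) = a \<bullet> (W *v (Y *v c))"
    by (metis inner_commute inner_transpose_mult)
  then have "a \<bullet> (Zn *v (Y *v c)) + ?w \<bullet> (Y *v c) = a \<bullet> (F *v (P *v c))"
    by (metis FP inner_add_right matrix_vector_mul_assoc matrix_vector_mult_add_rdistrib)
  also have "\<dots> = - (c \<bullet> (P *v c))"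
    using inner_transpose_mult[of a "transpose F" "P *v c"]
    by (simp add: c_def del: transpose_matrix_vector)
  finally have "c \<bullet> (P *v c) \<le> a \<bullet> (Pn *v a) - a \<bullet> a"
    using form[of ?w] noise_form_nonneg[OF noise, of a] by linarith
  moreover have "c \<bullet> (P *v c) = (transpose F *v a) \<bullet> (P *v (transpose F *v a))"
    by (simp add: c_def vec.neg)
  ultimately show ?thesis by simp
qed

lemma matrix_inv_mult_left: "invertible M \<Longrightarrow> matrix_inv M ** M = mat 1"
  unfolding invertible_def matrix_inv_def by (rule someI2_ex) auto

lemma invertible_if_form_pos:
  fixes M :: "real ^ 'n ^ 'n"
  assumes "\<eta> > 0" and "\<And>x. \<eta> * (x \<bullet> x) \<le> x \<bullet> (M *v x)"
  shows "invertible M"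
proof -
  have "x = 0" if "M *v x = 0" for x
    using assms(2)[of x] that \<open>\<eta> > 0\<close>
    by (metis inner_eq_zero_iff inner_ge_zero inner_zero_right mult_le_0_iff not_le order_antisym)
  then show ?thesis
    using invertible_left_inverse matrix_left_invertible_ker by blast
qed

lemma matrix_mult_add_left:
  fixes M N :: "real ^ 'c ^ 'r"
  shows "(M + N) ** L = M ** L + N ** L"
  by (simp add: matrix_matrix_mult_def vec_eq_iff sum.distrib distrib_right)

lemma data_matrix_mult: "M ** data_matrix z k = data_matrix (\<lambda>j k. M *v z j k) k"
  by (simp add: data_matrix_def matrix_matrix_mult_def matrix_vector_mult_def)

text \<open>This is where the data replace the plant: each experiment satisfies the plant equation, and
  its process noise and the measurement noise at the two ends of the step make up \<open>W\<close>.\<close>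

lemma data_equation:
  assumes "\<And>j. x j (k + 1) = A *v x j k + B *v u j k + d j k"
    and "\<And>j i. i \<in> {k, k + 1} \<Longrightarrow> \<zeta> j i = x j i + v j i"
  shows "A ** data_matrix \<zeta> k + B ** data_matrix u k
    = data_matrix \<zeta> (k + 1) + (A ** data_matrix v k - data_matrix v (k + 1) - data_matrix d k)"
proof -
  have "A *v \<zeta> j k + B *v u j k = \<zeta> j (k + 1) + (A *v v j k - v j (k + 1) - d j k)" for j
    using assms by (simp add: matrix_vector_right_distrib)
  then show ?thesis
    by (simp only: data_matrix_mult) (simp add: data_matrix_def vec_eq_iff)
qed

text \<open>The gain is chosen so that \<open>K P = U Y\<close>; together with \<open>P = Z Y\<close> this
  factors \<open>Y\<close> out of \<open>A P + B K P\<close> and leaves \<open>A Z + B U\<close>, which the data equation evaluates.\<close>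

lemma closed_loop_times_P:
  fixes A :: "real ^ 'n ^ 'n" and B :: "real ^ 'm ^ 'n"
    and Z Zn W :: "real ^ 'l ^ 'n" and U :: "real ^ 'l ^ 'm"
  assumes "A ** Z + B ** U = Zn + W" and "Z ** Y = P" and "invertible P"
  shows "(A + B ** (U ** Y ** matrix_inv P)) ** P = (Zn + W) ** Y"
proof -
  have "(A + B ** (U ** Y ** matrix_inv P)) ** P = A ** P + B ** (U ** Y ** (matrix_inv P ** P))"
    by (simp add: matrix_mult_add_left matrix_mul_assoc)
  also have "\<dots> = (A ** Z + B ** U) ** Y"
    using assms(2,3) by (simp add: matrix_inv_mult_left matrix_mult_add_left flip: matrix_mul_assoc)
  finally show ?thesis using assms(1) by simp
qed

section \<open>Decay of the transition matrix\<close>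

primrec transition :: "(nat \<Rightarrow> real ^ 'n ^ 'n) \<Rightarrow> nat \<Rightarrow> real ^ 'n ^ 'n" where
  "transition F 0 = mat 1"
| "transition F (Suc k) = F k ** transition F k"

text \<open>The bound \<open>P (k + 1) \<preceq> \<rho> I\<close> makes the decrease \<open>a \<bullet> a\<close> in one step at least the fraction \<open>1 / \<rho>\<close> of
  \<open>a \<bullet> (P (k + 1) a)\<close>. Since \<open>\<Phi> (k + 1)\<^sup>T a = \<Phi> k\<^sup>T (F k\<^sup>T a)\<close>, the induction must
  be over all \<open>a\<close>.\<close>

lemma transition_form_decay:
  assumes step: "\<And>k a. k < T \<Longrightarrow>
      (transpose (F k) *v a) \<bullet> (P k *v (transpose (F k) *v a)) + a \<bullet> a \<le> a \<bullet> (P (k + 1) *v a)"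
    and upper: "\<And>k a. k \<le> T \<Longrightarrow> a \<bullet> (P k *v a) \<le> \<rho> * (a \<bullet> a)"
    and "\<rho> \<ge> 1" and "k \<le> T"
  shows "(transpose (transition F k) *v a) \<bullet> (P 0 *v (transpose (transition F k) *v a))
    \<le> (1 - 1 / \<rho>) ^ k * (a \<bullet> (P k *v a))"
  using \<open>k \<le> T\<close>
proof (induction k arbitrary: a)
  case 0
  then show ?case by simp
next
  case (Suc k)
  let ?b = "transpose (F k) *v a"
  have "transpose (transition F (Suc k)) *v a = transpose (transition F k) *v ?b"
    by (simp add: matrix_transpose_mul flip: matrix_vector_mul_assoc)
  then have "(transpose (transition F (Suc k)) *v a)
      \<bullet> (P 0 *v (transpose (transition F (Suc k)) *v a)) \<le> (1 - 1 / \<rho>) ^ k * (?b \<bullet> (P k *v ?b))"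
    using Suc by simp
  also have "\<dots> \<le> (1 - 1 / \<rho>) ^ k * ((1 - 1 / \<rho>) * (a \<bullet> (P (Suc k) *v a)))"
  proof (rule mult_left_mono)
    have "(a \<bullet> (P (Suc k) *v a)) / \<rho> \<le> a \<bullet> a"
      using upper[of "Suc k" a] Suc.prems \<open>\<rho> \<ge> 1\<close> by (simp add: field_simps)
    then show "?b \<bullet> (P k *v ?b) \<le> (1 - 1 / \<rho>) * (a \<bullet> (P (Suc k) *v a))"
      using step[of k a] Suc.prems by (simp add: left_diff_distrib)
  qed (use \<open>\<rho> \<ge> 1\<close> in simp)
  finally show ?case by (simp add: mult_ac)
qed

text \<open>The Lyapunov inequality speaks of the transposed transition matrix, the trajectory of the matrix
  itself; Cauchy-Schwarz applied to \<open>\<parallel>M x\<parallel>\<^sup>2 = x \<bullet> (M\<^sup>T M x)\<close> passes from one to the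
  other.\<close>

lemma norm_mult_le_if_transpose:
  fixes M :: "real ^ 'c ^ 'r"
  assumes "\<And>a. norm (transpose M *v a) \<le> c * norm a"
  shows "norm (M *v x) \<le> c * norm x"
proof -
  have "norm (M *v x) * norm (M *v x) = x \<bullet> (transpose M *v (M *v x))"
    by (simp add: inner_transpose_mult power2_norm_eq_inner del: transpose_matrix_vector
        flip: power2_eq_square)
  also have "\<dots> \<le> norm x * (c * norm (M *v x))"
    by (meson assms mult_left_mono norm_cauchy_schwarz norm_ge_zero order_trans)
  finally have *: "norm (M *v x) * norm (M *v x) \<le> (c * norm x) * norm (M *v x)"
    by (simp add: mult_ac)
  show ?thesis
  proof (cases "M *v x = 0")
    case True
    have "0 \<le> c"
      using order_trans[OF norm_ge_zero assms, of "axis undefined 1"] by simp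
    with True show ?thesis by simp
  next
    case False
    with * show ?thesis by simp
  qed
qed

lemma transition_norm_bound:
  assumes step: "\<And>k a. k < T \<Longrightarrow>
      (transpose (F k) *v a) \<bullet> (P k *v (transpose (F k) *v a)) + a \<bullet> a \<le> a \<bullet> (P (k + 1) *v a)"
    and upper: "\<And>k a. k \<le> T \<Longrightarrow> a \<bullet> (P k *v a) \<le> \<rho> * (a \<bullet> a)"
    and lower: "\<And>a. \<eta> * (a \<bullet> a) \<le> a \<bullet> (P 0 *v a)"
    and "\<eta> > 0" and "\<rho> > 1" and "k \<le> T"
  shows "norm (transition F k *v x) \<le> sqrt (\<rho> / \<eta>) * (1 - 1 / \<rho>) powr (real k / 2) * norm x"
proof (rule norm_mult_le_if_transpose)
  fix a
  let ?b = "transpose (transition F k) *v a" and ?l = "1 - 1 / \<rho>"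
  have l: "?l > 0" using \<open>\<rho> > 1\<close> by simp
  have "\<eta> * (norm ?b)\<^sup>2 \<le> ?l ^ k * (a \<bullet> (P k *v a))"
    using lower[of ?b] transition_form_decay[of T F P \<rho> k a, OF step upper] \<open>\<rho> > 1\<close> \<open>k \<le> T\<close>
    by (simp add: power2_norm_eq_inner)
  also have "\<dots> \<le> ?l ^ k * (\<rho> * (norm a)\<^sup>2)"
    using l upper[OF \<open>k \<le> T\<close>, of a] by (simp add: power2_norm_eq_inner)
  finally have "(norm ?b)\<^sup>2 \<le> \<rho> / \<eta> * ?l ^ k * (norm a)\<^sup>2"
    using \<open>\<eta> > 0\<close> by (simp add: field_simps)
  then have "norm ?b \<le> sqrt (\<rho> / \<eta> * ?l ^ k * (norm a)\<^sup>2)"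
    by (rule real_le_rsqrt)
  also have "\<dots> = sqrt (\<rho> / \<eta>) * sqrt (?l ^ k) * norm a"
    by (simp only: real_sqrt_mult real_sqrt_abs abs_norm_cancel)
  also have "sqrt (?l ^ k) = ?l powr (real k / 2)"
    using l by (simp add: powr_powr flip: powr_half_sqrt powr_realpow)
  finally show "norm ?b \<le> sqrt (\<rho> / \<eta>) * ?l powr (real k / 2) * norm a" .
qed

section \<open>Response to the noise\<close>

lemma sup_norm_nat: "sup_norm z (int k) = (SUP j\<in>{..k}. norm (z j))"
  by (simp add: sup_norm_def atMost_def)

lemma norm_le_sup_norm: "j \<le> k \<Longrightarrow> norm (z j) \<le> sup_norm z (int k)"
  by (auto simp: sup_norm_nat intro!: cSUP_upper)

lemma sup_norm_nonneg: "0 \<le> sup_norm z (int k - 1)"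
proof (cases k)
  case (Suc i)
  then show ?thesis
    using order_trans[OF norm_ge_zero norm_le_sup_norm[of 0 i z]] by simp
qed (simp add: sup_norm_def)

lemma sup_norm_mono: "sup_norm z (int k - 1) \<le> sup_norm z (int k)"
proof (cases k)
  case 0
  then show ?thesis using norm_le_sup_norm[of 0 0 z] norm_ge_zero[of "z 0"]
    by (simp add: sup_norm_def)
next
  case (Suc i)
  then have "int k - 1 = int i" by simp
  then show ?thesis unfolding Suc
    by (auto simp only: sup_norm_nat intro!: cSUP_subset_mono) auto
qed

text \<open>The gain may grow with \<open>k\<close>, but it is chosen before the trajectory: only the matrices
  enter it.\<close>

lemma forced_response_gain:
  fixes F :: "nat \<Rightarrow> real ^ 'n ^ 'n" and G :: "nat \<Rightarrow> real ^ 'p ^ 'n"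
  shows "\<exists>g>0. \<forall>x v d. (\<forall>j<k. x (j + 1) = F j *v x j + G j *v v j + d j) \<longrightarrow>
    norm (x k - transition F k *v x 0) \<le> g * (sup_norm v (int k - 1) + sup_norm d (int k - 1))"
proof (induction k)
  case 0
  show ?case by (auto simp: sup_norm_def intro: exI[of _ 1])
next
  case (Suc k)
  then obtain g where "g > 0" and
    g: "\<And>x v d. \<forall>j<k. x (j + 1) = F j *v x j + G j *v v j + d j \<Longrightarrow>
      norm (x k - transition F k *v x 0) \<le> g * (sup_norm v (int k - 1) + sup_norm d (int k - 1))"
    by blast
  define f where "f = onorm ((*v) (F k))"
  define h where "h = onorm ((*v) (G k))"
  have f: "norm (F k *v y) \<le> f * norm y" "0 \<le> f" for y
    unfolding f_def by (auto intro!: onorm onorm_pos_le matrix_vector_mul_bounded_linear)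
  have h: "norm (G k *v y) \<le> h * norm y" "0 \<le> h" for y
    unfolding h_def by (auto intro!: onorm onorm_pos_le matrix_vector_mul_bounded_linear)
  have "norm (x (Suc k) - transition F (Suc k) *v x 0)
      \<le> (f * g + h + 1) * (sup_norm v (int k) + sup_norm d (int k))"
    if x: "\<forall>j<Suc k. x (j + 1) = F j *v x j + G j *v v j + d j" for x v d
  proof -
    let ?e = "x k - transition F k *v x 0" and ?s = "sup_norm v (int k) + sup_norm d (int k)"
    have sv: "0 \<le> sup_norm v (int k)" and sd: "0 \<le> sup_norm d (int k)"
      using sup_norm_nonneg[of _ "Suc k"] by simp_all
    have "norm ?e \<le> g * (sup_norm v (int k - 1) + sup_norm d (int k - 1))"
      using x by (intro g) auto
    also have "\<dots> \<le> g * ?s"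
      using \<open>g > 0\<close> sup_norm_mono[of v k] sup_norm_mono[of d k] by simp
    finally have e: "norm ?e \<le> g * ?s" .
    have "x (Suc k) - transition F (Suc k) *v x 0 = F k *v ?e + G k *v v k + d k"
      using x by (simp add: matrix_vector_mult_diff_distrib flip: matrix_vector_mul_assoc)
    then have "norm (x (Suc k) - transition F (Suc k) *v x 0)
        \<le> norm (F k *v ?e) + norm (G k *v v k) + norm (d k)"
      using norm_triangle_ineq[of "F k *v ?e + G k *v v k" "d k"]
        norm_triangle_ineq[of "F k *v ?e" "G k *v v k"] by simp
    also have "\<dots> \<le> f * (g * ?s) + h * ?s + ?s"
    proof (intro add_mono)
      show "norm (F k *v ?e) \<le> f * (g * ?s)"
        using f e by (meson mult_left_mono order_trans)
      have "norm (v k) \<le> ?s" using norm_le_sup_norm[of k k v] sd by simp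
      then show "norm (G k *v v k) \<le> h * ?s"
        using h by (meson mult_left_mono order_trans)
      show "norm (d k) \<le> ?s" using norm_le_sup_norm[of k k d] sv by simp
    qed
    finally show ?thesis by (simp add: algebra_simps)
  qed
  moreover have "f * g + h + 1 > 0" using \<open>g > 0\<close> f h by (simp add: add_nonneg_pos)
  ultimately show ?case by (intro exI[of _ "f * g + h + 1"]) simp
qed

lemma class_K_linear: "g > 0 \<Longrightarrow> class_K (\<lambda>r. g * r)"
  by (auto simp: class_K_def strict_mono_on_def intro!: continuous_intros)

section \<open>The closed loop\<close>

theorem theorem3:
  fixes T :: nat
    and A :: "nat \<Rightarrow> real ^ 'n ^ 'n"
    and B :: "nat \<Rightarrow> real ^ 'm ^ 'n"
    and x\<^sub>d v\<^sub>d d\<^sub>d \<zeta>\<^sub>d :: "'l::finite \<Rightarrow> nat \<Rightarrow> real ^ 'n"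
    and u\<^sub>d :: "'l \<Rightarrow> nat \<Rightarrow> real ^ 'm"
    and Z V D W :: "nat \<Rightarrow> real ^ 'l ^ 'n"
    and U :: "nat \<Rightarrow> real ^ 'l ^ 'm"
    and Q\<^sub>r :: "nat \<Rightarrow> real ^ 'n ^ 'n"
    and S\<^sub>r :: "nat \<Rightarrow> real ^ 'l ^ 'n"
    and R\<^sub>r :: "nat \<Rightarrow> real ^ 'l ^ 'l"
    and \<eta> \<rho> :: real
    and Y :: "nat \<Rightarrow> real ^ 'n ^ 'l"
    and P :: "nat \<Rightarrow> real ^ 'n ^ 'n"
    and K :: "nat \<Rightarrow> real ^ 'n ^ 'm"
  assumes data_state: "\<And>j k. k < T \<Longrightarrow>
        x\<^sub>d j (k + 1) = A k *v x\<^sub>d j k + B k *v u\<^sub>d j k + d\<^sub>d j k"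
    and data_meas: "\<And>j k. k \<le> T \<Longrightarrow> \<zeta>\<^sub>d j k = x\<^sub>d j k + v\<^sub>d j k"
    and Z: "\<And>k. k \<le> T \<Longrightarrow> Z k = data_matrix \<zeta>\<^sub>d k"
    and V: "\<And>k. k \<le> T \<Longrightarrow> V k = data_matrix v\<^sub>d k"
    and U: "\<And>k. k < T \<Longrightarrow> U k = data_matrix u\<^sub>d k"
    and D: "\<And>k. k < T \<Longrightarrow> D k = data_matrix d\<^sub>d k"
    and rank_data: "\<And>k. k < T \<Longrightarrow> rank (vcat (Z k) (U k)) = CARD('n) + CARD('m)"
    and W: "\<And>k. k < T \<Longrightarrow> W k = A k ** V k - V (k + 1) - D k"
    and noise_bound: "\<And>k. k < T \<Longrightarrow>
        0 \<preceq> transpose (vcat (mat 1) (transpose (W k)))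
              ** block2 (Q\<^sub>r k)             (S\<^sub>r k)
                        (transpose (S\<^sub>r k)) (R\<^sub>r k)
              ** vcat (mat 1) (transpose (W k))"
    and Q_sym: "\<And>k. k < T \<Longrightarrow> symmetric_mat (Q\<^sub>r k)"
    and R_sym: "\<And>k. k < T \<Longrightarrow> symmetric_mat (R\<^sub>r k)"
    and R_neg: "\<And>k. k < T \<Longrightarrow> R\<^sub>r k \<prec> 0"
    and eta: "\<eta> \<ge> 1"
    and rho: "\<rho> > \<eta>"
    and P_sym: "\<And>k. k \<le> T \<Longrightarrow> symmetric_mat (P k)"
    and LMI: "\<And>k. k < T \<Longrightarrow>
        0 \<prec> block3 (P (k + 1) - mat 1 - Q\<^sub>r k)             (- S\<^sub>r k)         (Z (k + 1) ** Y k)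
                    (- transpose (S\<^sub>r k))                   (- R\<^sub>r k)         (Y k)
                    (transpose (Y k) ** transpose (Z (k + 1))) (transpose (Y k)) (P k)"
    and ZY: "\<And>k. k < T \<Longrightarrow> Z k ** Y k = P k"
    and P_lower: "\<And>k. k \<le> T \<Longrightarrow> \<eta> *\<^sub>R mat 1 \<preceq> P k"
    and P_upper: "\<And>k. k \<le> T \<Longrightarrow> P k \<preceq> \<rho> *\<^sub>R mat 1"
    and K: "\<And>k. k < T \<Longrightarrow> K k = U k ** Y k ** matrix_inv (P k)"
  shows "\<exists>\<gamma>\<^sub>1 \<gamma>\<^sub>2 :: real \<Rightarrow> nat \<Rightarrow> real.
      (\<forall>k\<le>T. class_K (\<lambda>r. \<gamma>\<^sub>1 r k) \<and> class_K (\<lambda>r. \<gamma>\<^sub>2 r k)) \<and>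
      (\<forall>x v d :: nat \<Rightarrow> real ^ 'n.
        (\<forall>k<T. x (k + 1) = (A k + B k ** K k) *v x k + (B k ** K k) *v v k + d k) \<longrightarrow>
        (\<forall>k\<le>T. norm (x k) \<le>
            sqrt (\<rho> / \<eta>) * (1 - 1 / \<rho>) powr (real k / 2) * norm (x 0)
            + \<gamma>\<^sub>1 (sup_norm v (int k - 1)) k
            + \<gamma>\<^sub>2 (sup_norm d (int k - 1)) k))"
proof -
  define F where "F k = A k + B k ** K k" for k
  have lower: "\<eta> * (a \<bullet> a) \<le> a \<bullet> (P k *v a)" if "k \<le> T" for k a
    using P_lower[OF that]
    by (simp add: mat_le_def matrix_vector_mult_diff_rdistrib inner_diff_right scaleR_mat_1_mult)
  have upper: "a \<bullet> (P k *v a) \<le> \<rho> * (a \<bullet> a)" if "k \<le> T" for k a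
    using P_upper[OF that]
    by (simp add: mat_le_def matrix_vector_mult_diff_rdistrib inner_diff_right scaleR_mat_1_mult)
  have FP: "F k ** P k = (Z (k + 1) + W k) ** Y k" if k: "k < T" for k
    unfolding F_def K[OF k]
  proof (rule closed_loop_times_P)
    have "A k ** data_matrix \<zeta>\<^sub>d k + B k ** data_matrix u\<^sub>d k = data_matrix \<zeta>\<^sub>d (k + 1)
        + (A k ** data_matrix v\<^sub>d k - data_matrix v\<^sub>d (k + 1) - data_matrix d\<^sub>d k)"
      using k data_state data_meas
      by (intro data_equation[of x\<^sub>d k "A k" "B k" u\<^sub>d d\<^sub>d \<zeta>\<^sub>d v\<^sub>d]) auto
    with k show "A k ** Z k + B k ** U k = Z (k + 1) + W k"
      by (simp add: Z U V D W)
    show "invertible (P k)"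
      using eta lower[of k] k by (intro invertible_if_form_pos[of \<eta>]) auto
  qed (rule ZY[OF k])
  have step: "(transpose (F k) *v a) \<bullet> (P k *v (transpose (F k) *v a)) + a \<bullet> a
      \<le> a \<bullet> (P (k + 1) *v a)" if "k < T" for k a
    by (rule lyapunov_step[OF noise_bound[OF that] LMI[OF that] FP[OF that]])
  have decay: "norm (transition F k *v y)
      \<le> sqrt (\<rho> / \<eta>) * (1 - 1 / \<rho>) powr (real k / 2) * norm y" if "k \<le> T" for k y
    by (rule transition_norm_bound[of T F P, OF step upper lower])
      (use eta rho that in auto)
  obtain g where g_pos: "\<And>k. g k > 0" and
    g: "\<And>k x v d. \<forall>j<k. x (j + 1) = F j *v x j + (B j ** K j) *v v j + d j \<Longrightarrow>
      norm (x k - transition F k *v x 0)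
        \<le> g k * (sup_norm v (int k - 1) + sup_norm d (int k - 1))"
    using forced_response_gain[of _ F "\<lambda>j. B j ** K j"] by metis
  show ?thesis
  proof (intro exI conjI allI impI)
    \<comment> \<open>The beta-redexes fix the witness \<open>\<lambda>r k. g k * r\<close> for both gain functions.\<close>
    show "class_K (\<lambda>r. (\<lambda>r k. g k * r) r k)" "class_K (\<lambda>r. (\<lambda>r k. g k * r) r k)" for k
      using g_pos class_K_linear by simp_all
    fix x v d :: "nat \<Rightarrow> real ^ 'n" and k
    assume x: "\<forall>k<T. x (k + 1) = (A k + B k ** K k) *v x k + (B k ** K k) *v v k + d k"
      and k: "k \<le> T"
    have "norm (x k) \<le> norm (transition F k *v x 0) + norm (x k - transition F k *v x 0)"
      by (rule norm_triangle_sub)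
    also have "\<dots> \<le> sqrt (\<rho> / \<eta>) * (1 - 1 / \<rho>) powr (real k / 2) * norm (x 0)
        + g k * (sup_norm v (int k - 1) + sup_norm d (int k - 1))"
      using x k by (intro add_mono decay g) (auto simp: F_def)
    finally show "norm (x k) \<le> sqrt (\<rho> / \<eta>) * (1 - 1 / \<rho>) powr (real k / 2) * norm (x 0)
        + g k * sup_norm v (int k - 1) + g k * sup_norm d (int k - 1)"
      by (simp add: distrib_left)
  qed
qed

end
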